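(* Let $\mathcal{T}$ be an admissible mesh of $\Omega$ satisfying the regularity requirement with parameter $\xi>0$. Let $0<q<2$, $p>0$ with $pq\ge 1$, and $f\in X(\mathcal{T})$. Then $$\|f\|_{0,q,\mathcal{T}}^{2-q}\left(\int_\Omega |f|^q\,dx-\left(\int_\Omega |f|^{1/p}\,dx\right)^{pq}\right)\le C_b'(p,q)\,|f|_{1,2,\mathcal{T}}^2,$$ where $$C_b'(p,q)=\frac{q(pq-1)C_p^2}{(2-q)\xi}\ \text{ if } 1\le q<2,\qquad C_b'(p,q)=\frac{(pq-1)C_p^2}{\xi}\ \text{ if } 0<q<1,$$ and $C_p$ is the constant in the discrete Poincaré-Wirtinger inequality.
   Context: $\Omega\subset\mathbb{R}^d$ ($d\ge2$) is an open bounded polyhedral set with Lipschitz boundary; $\mathrm{m}$ denotes Lebesgue measure in $\mathbb{R}^d$ or $\mathbb{R}^{d-1}$, $\mathrm{d}$ the Euclidean distance, and $\mathrm{m}(\Omega)=1$. Admissible mesh: a finite family $\mathcal{T}$ of control volumes (open convex polyhedral subsets of $\Omega$ of positive measure, pairwise disjoint, whose closures cover $\overline\Omega$), a family $\mathcal{E}$ of faces (relatively open parts of hyperplanes, of positive $(d-1)$-measure; for each $K\in\mathcal{T}$ there is $\mathcal{E}_K\subset\mathcal{E}$ with $\partial K=\bigcup_{\sigma\in\mathcal{E}_K}\overline\sigma$, and $\mathcal{E}=\bigcup_K\mathcal{E}_K$), and points $(x_K)_{K\in\mathcal{T}}$ with $x_K\in\overline K$, such that for $K\ne L$ either $\overline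 K\cap\overline L$ has zero $(d-1)$-measure or $\overline K\cap\overline L=\overline\sigma$ for some $\sigma\in\mathcal{E}$, denoted $\sigma=K|L$; in the latter case $x_K\neq x_L$ and the line through $x_K$ and $x_L$ is orthogonal to $\sigma$; and for a boundary face $\sigma\subset\partial\Omega$ of $K$ with $x_K\notin\sigma$, the line through $x_K$ orthogonal to $\sigma$ intersects $\sigma$. $\mathcal{E}_{\rm int}$ is the set of interior faces and $\mathcal{E}_{{\rm int},K}$ the set of interior faces of $K$. Regularity requirement: there is $\xi>0$ with $\mathrm{d}(x_K,\sigma)\ge\xi\,\mathrm{d}(x_K,x_L)$ for all $K\in\mathcal{T}$ and all $\sigma=K|L\in\mathcal{E}_{{\rm int},K}$. $X(\mathcal{T})$ is the space of functions $\Omega\to\mathbb{R}$ that are constant on each $K\in\mathcal{T}$ (value $f_K$ on $K$). For $\sigma=K|L\in\mathcal{E}_{\rm int}$, $d_\sigma=\mathrm{d}(x_K,x_L)$. Set $$\|f\|_{0,q,\mathcal{T}}=\Big(\sum_{K\in\mathcal{T}}\mathrm{m}(K)|f_K|^q\Big)^{1/q}\ (\text{also for } q<1),\qquad |f|_{1,2,\mathcal{T}}=\Big(\sum_{\sigma\in\mathcal{E}_{\rm int},\,\sigma=K|L}\frac{\mathrm{m}(\sigma)}{d_\sigma}|f_K-f_L|^2\Big)^{1/2}.$$ Discrete Poincaré-Wirtinger inequality (known): there is a constant $C_p>0$ depending only on $d$ and $\Omega$ such that $\|f-\bar f\|_{0,2,\mathcal{T}}\le C_p\,\xi^{-1/2}|f|_{1,2,\mathcal{T}}$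 for all $f\in X(\mathcal{T})$, where $\bar f=\int_\Omega f\,dx$. *)

theory Defs
  imports "HOL-Analysis.Analysis"
begin

definition polyhedral :: "'a::euclidean_space set \<Rightarrow> bool" where
  "polyhedral S \<longleftrightarrow> (\<exists>F. finite F \<and> (\<forall>P\<in>F. polytope P) \<and> closure S = \<Union>F)"

text \<open>Near every boundary point, after a rotation taking \<open>n\<close> to the last coordinate direction,
  \<open>\<Omega>\<close> is the part of a ball strictly above the graph of a Lipschitz function of the other
  \<open>d - 1\<close> coordinates.\<close>

definition lipschitz_boundary :: "'a::euclidean_space set \<Rightarrow> bool" where
  "lipschitz_boundary \<Omega> \<longleftrightarrow>
     (\<forall>z\<in>frontier \<Omega>. \<exists>n r C \<phi>. norm n = 1 \<and> r > 0 \<and> C-lipschitz_on {y. y \<bullet> n = 0} \<phi> \<and>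
        (\<forall>x\<in>ball z r. x \<in> \<Omega> \<longleftrightarrow> x \<bullet> n > \<phi> (x - (x \<bullet> n) *\<^sub>R n)))"

text \<open>\<open>hyperplane_frame S B\<close>: \<open>B\<close> is an orthonormal system of \<open>d - 1\<close> vectors
  spanning the direction space of a hyperplane that contains \<open>S\<close>.\<close>

definition hyperplane_frame :: "'a::euclidean_space set \<Rightarrow> 'a set \<Rightarrow> bool" where
  "hyperplane_frame S B \<longleftrightarrow>
     finite B \<and> card B = DIM('a) - 1 \<and> pairwise orthogonal B \<and> (\<forall>b\<in>B. norm b = 1) \<and>
     (\<forall>x\<in>S. \<forall>y\<in>S. x - y \<in> span B)"

text \<open>The \<open>(d - 1)\<close>-dimensional Lebesgue measure of a set contained in a hyperplane, computed in
  orthonormal coordinates of that hyperplane. By rotation invariance the value does not depend on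
  the frame; a set contained in two non-parallel hyperplanes has measure 0 in either frame.
  For sets not contained in a hyperplane the value is meaningless.\<close>

definition hyp_measure :: "'a::euclidean_space set \<Rightarrow> real" where
  "hyp_measure S =
     (let B = (SOME B. hyperplane_frame S B)
      in measure (\<Pi>\<^sub>M b\<in>B. lborel) ((\<lambda>x. \<lambda>b\<in>B. x \<bullet> b) ` S))"

definition orthogonal_to_set :: "'a::euclidean_space \<Rightarrow> 'a set \<Rightarrow> bool" where
  "orthogonal_to_set w S \<longleftrightarrow> (\<forall>x\<in>S. \<forall>y\<in>S. orthogonal w (x - y))"

record 'a mesh =
  cells :: "'a set set"
  faces_of :: "'a set \<Rightarrow> 'a set set"
  cell_point :: "'a set \<Rightarrow> 'a"

definition faces :: "'a mesh \<Rightarrow> 'a set set" where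
  "faces M = (\<Union>K\<in>cells M. faces_of M K)"

text \<open>The condition \<open>\<sigma> = rel_interior (closure \<sigma>)\<close> excludes relatively open sets with slits
  or punctures. Hence a face is determined by its closure, so that there is at most
  one face \<open>\<sigma> = K|L\<close> with \<open>closure \<sigma> = closure K \<inter> closure L\<close>, and it has the same measure as
  this intersection.\<close>

definition is_face :: "'a::euclidean_space set \<Rightarrow> bool" where
  "is_face \<sigma> \<longleftrightarrow>
     (\<exists>a b. a \<noteq> 0 \<and> openin (top_of_set {x. a \<bullet> x = b}) \<sigma>) \<and>
     \<sigma> = rel_interior (closure \<sigma>) \<and> hyp_measure \<sigma> > 0"

text \<open>\<open>common_face M \<sigma> K L\<close> is \<open>\<sigma> = K|L\<close>.\<close>

definition common_face :: "'a::euclidean_space mesh \<Rightarrow> 'a set \<Rightarrow> 'a set \<Rightarrow> 'a set \<Rightarrow> bool" where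
  "common_face M \<sigma> K L \<longleftrightarrow>
     K \<in> cells M \<and> L \<in> cells M \<and> K \<noteq> L \<and> \<sigma> \<in> faces M \<and> closure \<sigma> = closure K \<inter> closure L"

definition interior_faces :: "'a::euclidean_space mesh \<Rightarrow> 'a set set" where
  "interior_faces M = {\<sigma>. \<exists>K L. common_face M \<sigma> K L}"

definition admissible_mesh :: "'a::euclidean_space set \<Rightarrow> 'a mesh \<Rightarrow> bool" where
  "admissible_mesh \<Omega> M \<longleftrightarrow>
     finite (cells M) \<and>
     (\<forall>K\<in>cells M. open K \<and> convex K \<and> polytope (closure K) \<and> K \<subseteq> \<Omega> \<and> measure lebesgue K > 0) \<and>
     pairwise disjnt (cells M) \<and>
     (\<Union>K\<in>cells M. closure K) = closure \<Omega> \<and>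
     (\<forall>\<sigma>\<in>faces M. is_face \<sigma>) \<and>
     (\<forall>K\<in>cells M. frontier K = (\<Union>\<sigma>\<in>faces_of M K. closure \<sigma>)) \<and>
     (\<forall>K\<in>cells M. cell_point M K \<in> closure K) \<and>
     (\<forall>K\<in>cells M. \<forall>L\<in>cells M. K \<noteq> L \<longrightarrow>
        hyp_measure (closure K \<inter> closure L) = 0 \<or> (\<exists>\<sigma>. common_face M \<sigma> K L)) \<and>
     (\<forall>\<sigma> K L. common_face M \<sigma> K L \<longrightarrow>
        cell_point M K \<noteq> cell_point M L \<and>
        orthogonal_to_set (cell_point M L - cell_point M K) \<sigma>) \<and>
     (\<forall>K\<in>cells M. \<forall>\<sigma>\<in>faces_of M K. \<sigma> \<subseteq> frontier \<Omega> \<and> cell_point M K \<notin> \<sigma> \<longrightarrow>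
        (\<exists>y\<in>\<sigma>. orthogonal_to_set (y - cell_point M K) \<sigma>))"

definition regular_mesh :: "real \<Rightarrow> 'a::euclidean_space mesh \<Rightarrow> bool" where
  "regular_mesh \<xi> M \<longleftrightarrow>
     (\<forall>K L \<sigma>. common_face M \<sigma> K L \<longrightarrow>
        infdist (cell_point M K) \<sigma> \<ge> \<xi> * dist (cell_point M K) (cell_point M L))"

text \<open>Elements of \<open>X(T)\<close> are represented by functions on the whole space, only their values on
  \<open>\<Omega>\<close> being relevant. Values on the null set \<open>\<Omega> - \<Union>(cells M)\<close> are unconstrained.\<close>

definition discrete_functions :: "'a mesh \<Rightarrow> ('a \<Rightarrow> real) set" where
  "discrete_functions M = {f. \<forall>K\<in>cells M. f constant_on K}"

definition cell_value :: "('a \<Rightarrow> real) \<Rightarrow> 'a set \<Rightarrow> real" where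
  "cell_value f K = the_elem (f ` K)"

definition discrete_norm :: "'a::euclidean_space mesh \<Rightarrow> real \<Rightarrow> ('a \<Rightarrow> real) \<Rightarrow> real" where
  "discrete_norm M q f =
     (\<Sum>K\<in>cells M. measure lebesgue K * \<bar>cell_value f K\<bar> powr q) powr (1 / q)"

text \<open>The two cells adjacent to an interior face, in an arbitrary order; the expressions below
  are symmetric in them.\<close>

definition adjacent_cells :: "'a::euclidean_space mesh \<Rightarrow> 'a set \<Rightarrow> 'a set \<times> 'a set" where
  "adjacent_cells M \<sigma> = (SOME (K, L). common_face M \<sigma> K L)"

definition discrete_seminorm :: "'a::euclidean_space mesh \<Rightarrow> ('a \<Rightarrow> real) \<Rightarrow> real" where
  "discrete_seminorm M f =
     sqrt (\<Sum>\<sigma>\<in>interior_faces M.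
       (let (K, L) = adjacent_cells M \<sigma>
        in hyp_measure \<sigma> / dist (cell_point M K) (cell_point M L) *
           \<bar>cell_value f K - cell_value f L\<bar>\<^sup>2))"

text \<open>\<open>C\<close> is a constant for the discrete Poincare-Wirtinger inequality on \<open>\<Omega>\<close>, uniform over all
  admissible meshes and regularity parameters.\<close>

definition poincare_wirtinger_constant :: "'a::euclidean_space set \<Rightarrow> real \<Rightarrow> bool" where
  "poincare_wirtinger_constant \<Omega> C \<longleftrightarrow> C > 0 \<and>
     (\<forall>M \<xi> f. admissible_mesh \<Omega> M \<and> \<xi> > 0 \<and> regular_mesh \<xi> M \<and> f \<in> discrete_functions M \<longrightarrow>
        discrete_norm M 2 (\<lambda>x. f x - (LINT y:\<Omega>|lebesgue. f y))
          \<le> C * \<xi> powr (- 1 / 2) * discrete_seminorm M f)"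

definition beckner_constant :: "real \<Rightarrow> real \<Rightarrow> real \<Rightarrow> real \<Rightarrow> real" where
  "beckner_constant C \<xi> p q =
     (if 1 \<le> q then q * (p * q - 1) * C\<^sup>2 / ((2 - q) * \<xi>) else (p * q - 1) * C\<^sup>2 / \<xi>)"

end

theory Submission
  imports Defs
begin

text \<open>Only the cell values matter, so the claim concerns the power sums
  \<open>S s = (\<Sum>K. m K * \<bar>f\<^sub>K\<bar> powr s)\<close> of a probability vector.
  By Lyapunov's inequality \<open>ln S\<close> is convex; convexity at \<open>1 / p \<le> q < 2\<close> together with
  \<open>1 - 1 / x \<le> ln x \<le> x - 1\<close> bounds the left-hand side by
  \<open>(p q - 1) \<theta> (S 2 - S q powr (2 / q))\<close>, where \<open>\<theta> = q / (2 - q)\<close>. The deviation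
  \<open>S 2 - S q powr (2 / q)\<close> is at most the variance \<open>S 2 - (S 1)\<^sup>2\<close> if \<open>q \<ge> 1\<close>, and interpolating
  the exponent 1 between \<open>q\<close> and 2 bounds \<open>\<theta>\<close> times it by the variance if \<open>q < 1\<close>. The
  Poincare-Wirtinger inequality for \<open>\<bar>f\<bar>\<close>, whose seminorm does not exceed that of \<open>f\<close>,
  concludes.\<close>

section \<open>Power sums of a weighted family\<close>

definition weighted_power_sum :: "'i set \<Rightarrow> ('i \<Rightarrow> real) \<Rightarrow> ('i \<Rightarrow> real) \<Rightarrow> real \<Rightarrow> real" where
  "weighted_power_sum I m a s = (\<Sum>i\<in>I. m i * a i powr s)"

text \<open>The criterion does not mention \<open>s\<close>, so positivity at one exponent gives it
  at all, which legitimates the logarithms and quotients below. It rests on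
  \<open>0 powr s = 0\<close> for every \<open>s\<close>, including 0.\<close>

lemma weighted_power_sum_pos_iff:
  assumes "finite I" and "\<And>i. i \<in> I \<Longrightarrow> m i \<ge> 0" and "\<And>i. i \<in> I \<Longrightarrow> a i \<ge> 0"
  shows "weighted_power_sum I m a s > 0 \<longleftrightarrow> (\<exists>i\<in>I. m i > 0 \<and> a i > 0)"
proof
  assume "weighted_power_sum I m a s > 0"
  then obtain i where i: "i \<in> I" "m i * a i powr s > 0"
    unfolding weighted_power_sum_def by (meson not_less sum_nonpos)
  then have "m i \<noteq> 0" "a i \<noteq> 0" by auto
  with i assms(2,3)[OF i(1)] show "\<exists>i\<in>I. m i > 0 \<and> a i > 0"
    by (intro bexI[of _ i]) auto
next
  assume "\<exists>i\<in>I. m i > 0 \<and> a i > 0"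
  then obtain i where "i \<in> I" "m i > 0" "a i > 0" by blast
  then show "weighted_power_sum I m a s > 0"
    unfolding weighted_power_sum_def by (intro sum_pos2[of _ i]) (auto simp: assms)
qed

lemma weighted_power_sum_nonneg:
  assumes "\<And>i. i \<in> I \<Longrightarrow> m i \<ge> 0"
  shows "weighted_power_sum I m a s \<ge> 0"
  unfolding weighted_power_sum_def by (intro sum_nonneg) (auto simp: assms)

text \<open>Hoelder's inequality, proved by normalising: divide the terms at \<open>r\<close> and
  \<open>t\<close> by the sums \<open>A\<close> and \<open>B\<close>, apply the weighted Young
  inequality to each index, and sum. The normalised sums contribute
  \<open>l + (1 - l) = 1\<close>.\<close>

lemma Lyapunov_inequality:
  assumes I: "finite I" and m: "\<And>i. i \<in> I \<Longrightarrow> m i \<ge> 0" and a: "\<And>i. i \<in> I \<Longrightarrow> a i \<ge> 0"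
    and l: "0 \<le> l" "l \<le> 1"
  shows "weighted_power_sum I m a (l * r + (1 - l) * t)
    \<le> weighted_power_sum I m a r powr l * weighted_power_sum I m a t powr (1 - l)"
proof (cases "\<exists>i\<in>I. m i > 0 \<and> a i > 0")
  case False
  then have "\<not> weighted_power_sum I m a (l * r + (1 - l) * t) > 0"
    using weighted_power_sum_pos_iff[of I m a] I m a by simp
  \<comment> \<open>No index carries both weight and value, so the left side is not positive, while
    the right side is nonnegative.\<close>
  then show ?thesis by (smt (verit) mult_nonneg_nonneg powr_ge_zero)
next
  case True
  define A where "A = weighted_power_sum I m a r"
  define B where "B = weighted_power_sum I m a t"
  have AB: "A > 0" "B > 0"
    using True weighted_power_sum_pos_iff[of I m a] I m a by (simp_all add: A_def B_def)
  have "m i * a i powr (l * r + (1 - l) * t)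
      \<le> A powr l * B powr (1 - l) * (l * (m i * a i powr r) / A + (1 - l) * (m i * a i powr t) / B)"
    if "i \<in> I" for i
  proof (cases "a i = 0")
    case False
    then have ai: "a i > 0" using a[OF that] by simp
    have "a i powr (l * r + (1 - l) * t)
        = A powr l * B powr (1 - l) * ((a i powr r / A) powr l * (a i powr t / B) powr (1 - l))"
      using AB ai by (simp add: powr_divide powr_powr powr_add mult.commute)
    also have "\<dots> \<le> A powr l * B powr (1 - l) * (l * (a i powr r / A) + (1 - l) * (a i powr t / B))"
      by (intro mult_left_mono Youngs_inequality_0) (use l AB ai in auto)
    finally have "m i * a i powr (l * r + (1 - l) * t)
        \<le> m i * (A powr l * B powr (1 - l) * (l * (a i powr r / A) + (1 - l) * (a i powr t / B)))"
      using m[OF that] by (rule mult_left_mono)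
    also have "\<dots> = A powr l * B powr (1 - l)
        * (l * (m i * a i powr r) / A + (1 - l) * (m i * a i powr t) / B)"
      by (simp add: distrib_left mult_ac)
    finally show ?thesis .
  qed auto
  then have "weighted_power_sum I m a (l * r + (1 - l) * t)
      \<le> (\<Sum>i\<in>I. A powr l * B powr (1 - l)
            * (l * (m i * a i powr r) / A + (1 - l) * (m i * a i powr t) / B))"
    unfolding weighted_power_sum_def by (rule sum_mono)
  also have "\<dots> = A powr l * B powr (1 - l) * (l * A / A + (1 - l) * B / B)"
    unfolding A_def B_def weighted_power_sum_def
    by (simp add: sum.distrib sum_distrib_left sum_divide_distrib distrib_left)
  also have "\<dots> = A powr l * B powr (1 - l)" using AB by simp
  finally show ?thesis by (simp add: A_def B_def)
qed

text \<open>Both sides are homogeneous of degree 2 in \<open>a\<close>. Factoring out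
  \<open>Q\<close> leaves an inequality between scale-free ratios, which can be compared through
  their logarithms.\<close>

lemma power_sum_deviation_le:
  assumes I: "finite I" and m: "\<And>i. i \<in> I \<Longrightarrow> m i \<ge> 0" and a: "\<And>i. i \<in> I \<Longrightarrow> a i \<ge> 0"
    and q: "0 < q" "q < 2" and p: "p > 0" "p * q \<ge> 1"
  defines "S \<equiv> weighted_power_sum I m a"
  assumes pos: "S q > 0"
  shows "S q powr ((2 - q) / q) * (S q - S (1 / p) powr (p * q))
    \<le> (p * q - 1) * (q / (2 - q)) * (S 2 - S q powr (2 / q))"
proof -
  have pos': "S s > 0" for s
    using pos weighted_power_sum_pos_iff[of I m a] I m a unfolding S_def by simp
  have p2: "2 * p - 1 > 0"
  proof -
    have "p * q < p * 2" using p q by (intro mult_strict_left_mono) auto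
    with p show ?thesis by simp
  qed
  \<comment> \<open>The weight that places \<open>q\<close> between \<open>1 / p\<close> and 2;
    \<open>p * q \<ge> 1\<close> and \<open>q < 2\<close> put it in the unit interval.\<close>
  define l where "l = p * (2 - q) / (2 * p - 1)"
  have l: "0 \<le> l" "l \<le> 1" "1 - l = (p * q - 1) / (2 * p - 1)"
    using p p2 q by (auto simp: l_def field_simps)
  have "l * (2 * p - 1) = p * (2 - q)" using p2 by (simp add: l_def)
  then have l': "l * (1 / p) + (1 - l) * 2 = q"
    using p by (simp add: field_simps)
  have "S q \<le> S (1 / p) powr l * S 2 powr (1 - l)"
    using Lyapunov_inequality[of I m a l "1 / p" 2] I m a l(1,2) unfolding l'  S_def by simp
  then have "ln (S q) \<le> ln (S (1 / p) powr l * S 2 powr (1 - l))"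
    using pos pos'[of "1 / p"] pos'[of 2] by simp
  also have "\<dots> = l * ln (S (1 / p)) + (1 - l) * ln (S 2)"
    using pos'[of "1/p"] pos'[of 2] by (simp add: ln_mult ln_powr)
  finally have "(2 * p - 1) * ln (S q) \<le> (2 * p - 1) * (l * ln (S (1 / p)) + (1 - l) * ln (S 2))"
    using p2 by simp
  also have "\<dots> = p * (2 - q) * ln (S (1 / p)) + (p * q - 1) * ln (S 2)"
  proof -
    have "(2 * p - 1) * l = p * (2 - q)" "(2 * p - 1) * (1 - l) = p * q - 1"
      using p2 by (simp_all add: l(3)) (simp add: l_def)
    then show ?thesis by (metis distrib_left mult.assoc)
  qed
  finally have L: "(2 * p - 1) * ln (S q)
      \<le> p * (2 - q) * ln (S (1 / p)) + (p * q - 1) * ln (S 2)" .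
  \<comment> \<open>Chosen so that the left-hand side of the claim is
    \<open>Q * (1 - R)\<close>.\<close>
  define Q where "Q = S q powr (2 / q)"
  define R where "R = S (1 / p) powr (p * q) / S q"
  have Q: "Q > 0" and R: "R > 0" using pos pos'[of "1 / p"] by (auto simp: Q_def R_def)
  have lnQ: "ln Q = 2 / q * ln (S q)" using pos by (simp add: Q_def ln_powr)
  have lnR: "ln R = p * q * ln (S (1 / p)) - ln (S q)"
    using pos'[of q] pos'[of "1 / p"] by (simp add: R_def ln_div ln_powr)
  have "1 - R \<le> - ln R" using ln_le_minus_one[OF R] by simp
  also have "\<dots> \<le> (p * q - 1) * (q / (2 - q)) * (ln (S 2) - ln Q)"
  proof -
    have "(2 - q) * (- ln R) \<le> (p * q - 1) * (q * ln (S 2) - 2 * ln (S q))"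
      using mult_left_mono[OF L, of q] q unfolding lnR by (simp add: algebra_simps)
    moreover have "q * ln (S 2) - 2 * ln (S q) = q * (ln (S 2) - ln Q)"
      unfolding lnQ using q by (simp add: field_simps)
    ultimately show ?thesis using q by (simp add: field_simps)
  qed
  \<comment> \<open>The denominator \<open>Q\<close> produced by linearising the logarithm cancels
    against the factor taken out of the left side.\<close>
  also have "\<dots> \<le> (p * q - 1) * (q / (2 - q)) * ((S 2 - Q) / Q)"
    using q p by (intro mult_left_mono ln_diff_le pos' Q) auto
  finally have "Q * (1 - R) \<le> Q * ((p * q - 1) * (q / (2 - q)) * ((S 2 - Q) / Q))"
    using less_imp_le[OF Q] by (rule mult_left_mono)
  moreover have "Q * (1 - R) = S q powr ((2 - q) / q) * (S q - S (1 / p) powr (p * q))"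
  proof -
    have "Q = S q powr ((2 - q) / q) * S q"
      using pos q powr_add[of "S q" "(2 - q) / q" 1] by (simp add: Q_def field_simps)
    moreover have "S q * (1 - R) = S q - S (1 / p) powr (p * q)"
      using pos by (simp add: R_def field_simps)
    ultimately show ?thesis by simp
  qed
  moreover have "Q * ((p * q - 1) * (q / (2 - q)) * ((S 2 - Q) / Q))
      = (p * q - 1) * (q / (2 - q)) * (S 2 - Q)"
    using Q by simp
  ultimately show ?thesis by (simp only: Q_def)
qed

text \<open>Monotonicity of power means for a probability weight: Lyapunov's inequality with 1
  placed between 0 and \<open>q\<close>.\<close>

lemma power_sum_1_le:
  assumes I: "finite I" and m: "\<And>i. i \<in> I \<Longrightarrow> m i \<ge> 0" and a: "\<And>i. i \<in> I \<Longrightarrow> a i \<ge> 0"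
    and m1: "(\<Sum>i\<in>I. m i) = 1" and q: "1 \<le> q"
  shows "(weighted_power_sum I m a 1)\<^sup>2 \<le> weighted_power_sum I m a q powr (2 / q)"
proof -
  let ?S = "weighted_power_sum I m a"
  have nn: "?S s \<ge> 0" for s using m by (rule weighted_power_sum_nonneg)
  \<comment> \<open>not an equality, since \<open>0 powr 0 = 0\<close>\<close>
  have "?S 0 \<le> (\<Sum>i\<in>I. m i)"
    unfolding weighted_power_sum_def by (intro sum_mono) (auto simp: m powr_def)
  then have "?S 0 powr (1 - 1 / q) \<le> 1"
    using m1 nn q by (intro powr_le1) auto
  moreover have "?S 1 \<le> ?S 0 powr (1 - 1 / q) * ?S q powr (1 / q)"
    using Lyapunov_inequality[of I m a "1 - 1 / q" 0 q] I m a q by (simp add: field_simps)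
  ultimately have "?S 1 \<le> ?S q powr (1 / q)"
    by (meson mult_left_le_one_le order_trans powr_ge_zero)
  then have "(?S 1)\<^sup>2 \<le> (?S q powr (1 / q))\<^sup>2" using nn by (intro power_mono) auto
  also have "\<dots> = ?S q powr (2 / q)"
    by (simp add: power2_eq_square flip: powr_add)
  finally show ?thesis .
qed

text \<open>Interpolating 1 between \<open>q\<close> and 2 and squaring bounds
  \<open>(S 1)\<^sup>2\<close> by a weighted geometric mean of \<open>S q powr (2 / q)\<close> and
  \<open>S 2\<close>. Young's inequality replaces it by the arithmetic mean, and rearranging gives
  the claim.\<close>

lemma power_sum_deviation_le_variance:
  assumes I: "finite I" and m: "\<And>i. i \<in> I \<Longrightarrow> m i \<ge> 0" and a: "\<And>i. i \<in> I \<Longrightarrow> a i \<ge> 0"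
    and q: "0 < q" "q < 1"
  defines "S \<equiv> weighted_power_sum I m a"
  assumes pos: "S q > 0"
  shows "q / (2 - q) * (S 2 - S q powr (2 / q)) \<le> S 2 - (S 1)\<^sup>2"
proof -
  have pos': "S s > 0" for s
    using pos weighted_power_sum_pos_iff[of I m a] I m a unfolding S_def by simp
  define l where "l = 1 / (2 - q)"
  define \<theta> where "\<theta> = q / (2 - q)"
  have l: "0 \<le> l" "l \<le> 1" "l * (2 - q) = 1" and \<theta>_l: "\<theta> = q * l"
    using q by (auto simp: l_def \<theta>_def)
  then have l': "l * q + (1 - l) * 2 = 1" by (simp add: algebra_simps)
  have \<theta>: "0 \<le> \<theta>" "0 \<le> 1 - \<theta>" using q by (auto simp: \<theta>_def)
  \<comment> \<open>The doubled exponents, rewritten in terms of \<open>S q powr (2 / q)\<close> and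
    \<open>S 2\<close>, become weights with sum 1.\<close>
  have e: "l + l = 2 / q * \<theta>" "(1 - l) + (1 - l) = 1 - \<theta>"
    using q l(3) by (simp_all add: \<theta>_l algebra_simps)
  have "S 1 \<le> S q powr l * S 2 powr (1 - l)"
    using Lyapunov_inequality[of I m a l q 2] I m a l(1,2) unfolding l'  S_def by simp
  then have "(S 1)\<^sup>2 \<le> (S q powr l * S 2 powr (1 - l))\<^sup>2"
    using pos'[of 1] by (intro power_mono) auto
  also have "\<dots> = (S q powr l * S q powr l) * (S 2 powr (1 - l) * S 2 powr (1 - l))"
    by (simp add: power2_eq_square)
  also have "\<dots> = (S q powr (2 / q)) powr \<theta> * S 2 powr (1 - \<theta>)"
    unfolding powr_powr powr_add[symmetric] e ..
  also have "\<dots> \<le> \<theta> * S q powr (2 / q) + (1 - \<theta>) * S 2"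
    by (intro Youngs_inequality_0) (use \<theta> pos pos'[of 2] in auto)
  finally show ?thesis unfolding \<theta>_def[symmetric] by (simp add: algebra_simps)
qed

text \<open>Nonnegativity of \<open>a\<close> lets the real exponents 1 and 2 be read as ordinary
  powers.\<close>

lemma weighted_variance:
  assumes "(\<Sum>i\<in>I. m i) = 1" and a: "\<And>i. i \<in> I \<Longrightarrow> a i \<ge> (0::real)"
  defines "S \<equiv> weighted_power_sum I m a"
  shows "(\<Sum>i\<in>I. m i * (a i - S 1)\<^sup>2) = S 2 - (S 1)\<^sup>2"
proof -
  have S1: "S 1 = (\<Sum>i\<in>I. m i * a i)" and S2: "S 2 = (\<Sum>i\<in>I. m i * (a i)\<^sup>2)"
    unfolding S_def weighted_power_sum_def using a by (auto intro!: sum.cong simp: powr_numeral)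
  have "(\<Sum>i\<in>I. m i * (a i - S 1)\<^sup>2)
      = (\<Sum>i\<in>I. m i * (a i)\<^sup>2 - 2 * S 1 * (m i * a i) + (S 1)\<^sup>2 * m i)"
    by (intro sum.cong) (auto simp: power2_eq_square algebra_simps)
  also have "\<dots> = S 2 - 2 * S 1 * (\<Sum>i\<in>I. m i * a i) + (S 1)\<^sup>2 * (\<Sum>i\<in>I. m i)"
    unfolding S2 sum.distrib sum_subtractf sum_distrib_left[symmetric] ..
  also have "\<dots> = S 2 - 2 * S 1 * S 1 + (S 1)\<^sup>2"
    unfolding assms(1) S1[symmetric] by simp
  finally show ?thesis by (simp add: power2_eq_square)
qed

text \<open>The two forms of the constant arise here: for \<open>q \<ge> 1\<close> the factor
  \<open>q / (2 - q)\<close> is kept, for \<open>q < 1\<close> it is absorbed in passing to the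
  variance.\<close>

lemma Beckner_inequality_weighted_sum:
  assumes I: "finite I" and m: "\<And>i. i \<in> I \<Longrightarrow> m i \<ge> 0" and a: "\<And>i. i \<in> I \<Longrightarrow> a i \<ge> 0"
    and m1: "(\<Sum>i\<in>I. m i) = 1"
    and q: "0 < q" "q < 2" and p: "p > 0" "p * q \<ge> 1"
  defines "S \<equiv> weighted_power_sum I m a"
  shows "S q powr ((2 - q) / q) * (S q - S (1 / p) powr (p * q))
    \<le> (if 1 \<le> q then q * (p * q - 1) / (2 - q) else p * q - 1) * (S 2 - (S 1)\<^sup>2)"
    (is "?L \<le> ?c * ?V")
proof (cases "S q > 0")
  case False
  \<comment> \<open>Here the left side vanishes because \<open>0 powr x = 0\<close>.\<close>
  then have "S q = 0" using weighted_power_sum_nonneg[of I m a q] m by (simp add: S_def)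
  moreover have "?V \<ge> 0"
    using weighted_variance[of m I a] a m1 m
    by (metis (no_types, lifting) S_def mult_nonneg_nonneg sum_nonneg zero_le_power2)
  moreover have "?c \<ge> 0" using q p by auto
  ultimately show ?thesis by simp
next
  case True
  have *: "?L \<le> (p * q - 1) * (q / (2 - q)) * (S 2 - S q powr (2 / q))"
    using power_sum_deviation_le[of I m a q p] I m a q p True unfolding S_def by simp
  show ?thesis
  proof (cases "1 \<le> q")
    case True
    have "(p * q - 1) * (q / (2 - q)) * (S 2 - S q powr (2 / q)) \<le> (p * q - 1) * (q / (2 - q)) * ?V"
      using power_sum_1_le[of I m a q] I m a m1 q p True unfolding S_def
      by (intro mult_left_mono) auto
    with * True show ?thesis by (simp add: mult.commute)
  next
    case F: False
    have "(p * q - 1) * (q / (2 - q) * (S 2 - S q powr (2 / q))) \<le> (p * q - 1) * ?V"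
      using power_sum_deviation_le_variance[of I m a q] I m a q p True F unfolding S_def
      by (intro mult_left_mono) auto
    with * F show ?thesis by (simp add: mult.assoc)
  qed
qed

section \<open>Functions constant on the cells of an admissible mesh\<close>

lemma admissible_meshD:
  assumes "admissible_mesh \<Omega> M"
  shows "finite (cells M)" and "pairwise disjnt (cells M)"
    and "(\<Union>K\<in>cells M. closure K) = closure \<Omega>"
    and "K \<in> cells M \<Longrightarrow> open K" and "K \<in> cells M \<Longrightarrow> convex K" and "K \<in> cells M \<Longrightarrow> K \<subseteq> \<Omega>"
    and "K \<in> cells M \<Longrightarrow> measure lebesgue K > 0" and "K \<in> cells M \<Longrightarrow> K \<noteq> {}"
proof -
  note A = assms[unfolded admissible_mesh_def]
  show "finite (cells M)" using A by (rule conjunct1)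
  show "pairwise disjnt (cells M)" using A[THEN conjunct2, THEN conjunct2] by (rule conjunct1)
  show "(\<Union>K\<in>cells M. closure K) = closure \<Omega>"
    using A[THEN conjunct2, THEN conjunct2, THEN conjunct2] by (rule conjunct1)
  note K = A[THEN conjunct2, THEN conjunct1]
  show "K \<in> cells M \<Longrightarrow> open K" "K \<in> cells M \<Longrightarrow> convex K" "K \<in> cells M \<Longrightarrow> K \<subseteq> \<Omega>"
    and pos: "K \<in> cells M \<Longrightarrow> measure lebesgue K > 0"
    using K by blast+
  show "K \<in> cells M \<Longrightarrow> K \<noteq> {}" using pos by auto
qed

lemma cell_value_eq:
  assumes "f \<in> discrete_functions M" "K \<in> cells M" "x \<in> K"
  shows "cell_value f K = f x"
proof -
  have "f constant_on K" using assms by (simp add: discrete_functions_def)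
  then have "f ` K = {f x}" using \<open>x \<in> K\<close> by (auto simp: constant_on_def)
  then show ?thesis by (simp add: cell_value_def)
qed

lemma discrete_functions_comp:
  assumes "f \<in> discrete_functions M"
  shows "(\<lambda>x. h (f x)) \<in> discrete_functions M"
  unfolding discrete_functions_def
proof safe
  fix K assume "K \<in> cells M"
  then obtain y where "\<forall>x\<in>K. f x = y"
    using assms by (auto simp: discrete_functions_def constant_on_def)
  then show "(\<lambda>x. h (f x)) constant_on K" by (auto simp: constant_on_def)
qed

lemma cell_value_comp:
  assumes "f \<in> discrete_functions M" "K \<in> cells M" "K \<noteq> {}"
  shows "cell_value (\<lambda>x. h (f x)) K = h (cell_value f K)"
proof -
  obtain x where "x \<in> K" using assms by blast
  then show ?thesis using assms cell_value_eq discrete_functions_comp by metis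
qed

text \<open>The closures of the cells cover \<Omega>, so a point of \<Omega> outside all cells lies
  on the frontier of one. These are finitely many frontiers of convex sets, hence
  negligible.\<close>

lemma AE_in_cells:
  assumes "admissible_mesh \<Omega> M"
  shows "AE x in lebesgue. x \<in> \<Omega> \<longrightarrow> x \<in> \<Union>(cells M)"
proof (rule AE_I')
  have "negligible (\<Union>K\<in>cells M. frontier K)"
    using admissible_meshD[OF assms] by (intro negligible_Union) (auto simp: negligible_convex_frontier)
  then show "(\<Union>K\<in>cells M. frontier K) \<in> null_sets lebesgue"
    by (simp add: negligible_iff_null_sets)
  show "{x \<in> space lebesgue. \<not> (x \<in> \<Omega> \<longrightarrow> x \<in> \<Union>(cells M))} \<subseteq> (\<Union>K\<in>cells M. frontier K)"
  proof
    fix x assume "x \<in> {x \<in> space lebesgue. \<not> (x \<in> \<Omega> \<longrightarrow> x \<in> \<Union>(cells M))}"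
    then have x: "x \<in> \<Omega>" "x \<notin> \<Union>(cells M)" by auto
    then obtain K where "K \<in> cells M" "x \<in> closure K"
      using admissible_meshD(3)[OF assms] closure_subset[of \<Omega>] by blast
    then show "x \<in> (\<Union>K\<in>cells M. frontier K)"
      using x interior_subset[of K] unfolding frontier_def by blast
  qed
qed

text \<open>Values of \<open>g\<close> off the cells are arbitrary, so the integrand is compared
  almost everywhere with a step function \<open>s\<close>. Boundedness of \<Omega> makes the cells
  of finite measure.\<close>

lemma LINT_discrete_function:
  assumes M: "admissible_mesh \<Omega> M" and \<Omega>: "bounded \<Omega>" and g: "g \<in> discrete_functions M"
  shows "(LINT x:\<Omega>|lebesgue. g x) = (\<Sum>K\<in>cells M. measure lebesgue K * cell_value g K)"
proof -
  note D = admissible_meshD[OF M]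
  define s where "s = (\<lambda>x. \<Sum>K\<in>cells M. indicat_real K x * cell_value g K)"
  have K: "K \<in> lmeasurable" if "K \<in> cells M" for K
    using D(4,6)[OF that] \<Omega> by (meson bounded_subset lmeasurable_open)
  have int: "integrable lebesgue (\<lambda>x. indicat_real K x * cell_value g K)" if "K \<in> cells M" for K
    using K[OF that] by (intro integrable_mult_left integrable_real_indicator) (auto simp: fmeasurable_def)
  have s_meas: "s \<in> borel_measurable lebesgue"
    unfolding s_def using int by (intro borel_measurable_sum borel_measurable_integrable) auto
  have ae: "AE x in lebesgue. s x = indicat_real \<Omega> x *\<^sub>R g x"
    using AE_in_cells[OF M]
  proof eventually_elim
    case (elim x)
    show ?case
    proof (cases "\<exists>K\<in>cells M. x \<in> K")
      case False
      then have "x \<notin> \<Omega>" using elim by blast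
      then show ?thesis using False by (auto simp: s_def indicator_def intro!: sum.neutral)
    next
      case True
      then obtain K where K: "K \<in> cells M" "x \<in> K" by blast
      have "x \<notin> L" if "L \<in> cells M" "L \<noteq> K" for L
        using that K D(2) by (auto simp: pairwise_def disjnt_iff)
      then have "s x = (\<Sum>L\<in>cells M. if L = K then cell_value g K else 0)"
        unfolding s_def using K by (intro sum.cong) (auto simp: indicator_def)
      also have "\<dots> = g x" using K D(1) cell_value_eq[OF g K] by simp
      finally show ?thesis using K D(6) by (auto simp: indicator_def)
    qed
  qed
  \<comment> \<open>Measurability of \<open>g\<close> on \<Omega> is inherited from \<open>s\<close>
    by completeness of Lebesgue measure.\<close>
  have "(LINT x:\<Omega>|lebesgue. g x) = (LINT x|lebesgue. s x)"
    unfolding set_lebesgue_integral_def using ae borel_measurable_AE[OF s_meas ae] s_meas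
    by (intro integral_cong_AE) auto
  also have "\<dots> = (\<Sum>K\<in>cells M. LINT x|lebesgue. indicat_real K x * cell_value g K)"
    unfolding s_def using int by (rule Bochner_Integration.integral_sum)
  also have "\<dots> = (\<Sum>K\<in>cells M. measure lebesgue K * cell_value g K)"
    by simp
  finally show ?thesis .
qed

lemma measure_cells_sum:
  assumes M: "admissible_mesh \<Omega> M" and "open \<Omega>" and "bounded \<Omega>"
  shows "(\<Sum>K\<in>cells M. measure lebesgue K) = measure lebesgue \<Omega>"
proof -
  have one: "(\<lambda>x. 1) \<in> discrete_functions M"
    by (auto simp: discrete_functions_def constant_on_def)
  have "cell_value (\<lambda>x. 1) K = 1" if "K \<in> cells M" for K
    using cell_value_eq[OF one that] admissible_meshD(8)[OF M that] by blast
  then show ?thesis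
    using LINT_discrete_function[OF M \<open>bounded \<Omega>\<close> one] lmeasurable_open[OF \<open>bounded \<Omega>\<close> \<open>open \<Omega>\<close>]
    by (simp add: set_lebesgue_integral_def)
qed

section \<open>Jumps across interior faces and the discrete norms\<close>

lemma common_face_adjacent_cells:
  assumes "\<sigma> \<in> interior_faces M"
  shows "common_face M \<sigma> (fst (adjacent_cells M \<sigma>)) (snd (adjacent_cells M \<sigma>))"
proof -
  have "\<exists>KL. case KL of (K, L) \<Rightarrow> common_face M \<sigma> K L"
    using assms by (auto simp: interior_faces_def)
  then have "case adjacent_cells M \<sigma> of (K, L) \<Rightarrow> common_face M \<sigma> K L"
    unfolding adjacent_cells_def by (rule someI_ex)
  then show ?thesis by (simp add: case_prod_beta)
qed

lemma hyp_measure_nonneg: "hyp_measure S \<ge> 0"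
  by (simp add: hyp_measure_def Let_def)

text \<open>The reverse triangle inequality shrinks each jump, while the face weights depend on the
  mesh alone.\<close>

lemma discrete_seminorm_abs_le:
  assumes M: "admissible_mesh \<Omega> M" and f: "f \<in> discrete_functions M"
  shows "discrete_seminorm M (\<lambda>x. \<bar>f x\<bar>) \<le> discrete_seminorm M f"
proof -
  have "\<bar>cell_value (\<lambda>x. \<bar>f x\<bar>) K - cell_value (\<lambda>x. \<bar>f x\<bar>) L\<bar>\<^sup>2 \<le> \<bar>cell_value f K - cell_value f L\<bar>\<^sup>2"
    if "common_face M \<sigma> K L" for \<sigma> K L
  proof -
    have "K \<in> cells M" "L \<in> cells M" using that by (auto simp: common_face_def)
    then have "cell_value (\<lambda>x. \<bar>f x\<bar>) K = \<bar>cell_value f K\<bar>" "cell_value (\<lambda>x. \<bar>f x\<bar>) L = \<bar>cell_value f L\<bar>"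
      using cell_value_comp[OF f, of _ abs] admissible_meshD(8)[OF M] by auto
    then show ?thesis by (intro power_mono) auto
  qed
  note le = this[OF common_face_adjacent_cells]
  show ?thesis
    unfolding discrete_seminorm_def Let_def case_prod_beta
    by (intro real_sqrt_le_mono sum_mono mult_left_mono le divide_nonneg_nonneg
          hyp_measure_nonneg zero_le_dist)
qed

lemma discrete_norm_2_power2:
  "(discrete_norm M 2 f)\<^sup>2 = (\<Sum>K\<in>cells M. measure lebesgue K * (cell_value f K)\<^sup>2)"
proof -
  have "discrete_norm M 2 f = sqrt (\<Sum>K\<in>cells M. measure lebesgue K * (cell_value f K)\<^sup>2)"
    unfolding discrete_norm_def
    by (simp add: powr_half_sqrt sum_nonneg powr_numeral)
  then show ?thesis by (simp add: sum_nonneg)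
qed

theorem lemma13:
  fixes \<Omega> :: "'a::euclidean_space set"
    and M :: "'a mesh"
    and f :: "'a \<Rightarrow> real"
    and p q \<xi> C\<^sub>p :: real
  assumes "DIM('a) \<ge> 2"
    and "open \<Omega>" and "bounded \<Omega>" and "polyhedral \<Omega>" and "lipschitz_boundary \<Omega>"
    and "measure lebesgue \<Omega> = 1"
    and "poincare_wirtinger_constant \<Omega> C\<^sub>p"
    and "admissible_mesh \<Omega> M" and "\<xi> > 0" and "regular_mesh \<xi> M"
    and "0 < q" and "q < 2" and "p > 0" and "p * q \<ge> 1"
    and "f \<in> discrete_functions M"
  shows "discrete_norm M q f powr (2 - q) *
           ((LINT x:\<Omega>|lebesgue. \<bar>f x\<bar> powr q) -
            (LINT x:\<Omega>|lebesgue. \<bar>f x\<bar> powr (1 / p)) powr (p * q))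
         \<le> beckner_constant C\<^sub>p \<xi> p q * (discrete_seminorm M f)\<^sup>2"
proof -
  note M = \<open>admissible_mesh \<Omega> M\<close> and f = \<open>f \<in> discrete_functions M\<close>
  note D = admissible_meshD[OF M]
  define a where "a = (\<lambda>K. \<bar>cell_value f K\<bar>)"
  define S where "S = weighted_power_sum (cells M) (measure lebesgue) a"
  define V where "V = S 2 - (S 1)\<^sup>2"
  \<comment> \<open>The Beckner constant without its factor
    \<open>C\<^sub>p\<^sup>2 / \<xi>\<close>, which the Poincare-Wirtinger inequality
    supplies.\<close>
  define c where "c = (if 1 \<le> q then q * (p * q - 1) / (2 - q) else p * q - 1)"
  have m1: "(\<Sum>K\<in>cells M. measure lebesgue K) = 1"
    using measure_cells_sum[OF M] assms by simp
  have LINT: "(LINT x:\<Omega>|lebesgue. \<bar>f x\<bar> powr s) = S s" for s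
    using LINT_discrete_function[OF M \<open>bounded \<Omega>\<close> discrete_functions_comp[OF f, of "\<lambda>y. \<bar>y\<bar> powr s"]]
      cell_value_comp[OF f _ D(8), of _ "\<lambda>y. \<bar>y\<bar> powr s"]
    by (simp add: S_def weighted_power_sum_def a_def)
  have norm: "discrete_norm M q f powr (2 - q) = S q powr ((2 - q) / q)"
    by (simp add: discrete_norm_def S_def weighted_power_sum_def a_def powr_powr)
  have "discrete_norm M q f powr (2 - q) *
      ((LINT x:\<Omega>|lebesgue. \<bar>f x\<bar> powr q) - (LINT x:\<Omega>|lebesgue. \<bar>f x\<bar> powr (1 / p)) powr (p * q))
    \<le> c * V"
    unfolding LINT norm c_def V_def S_def
    by (rule Beckner_inequality_weighted_sum)
      (use assms D(1) m1 in \<open>auto simp: a_def\<close>)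
  also have "\<dots> \<le> c * (C\<^sub>p\<^sup>2 / \<xi> * (discrete_seminorm M f)\<^sup>2)"
  proof (rule mult_left_mono)
    \<comment> \<open>The absolute value is needed because \<open>V\<close> is the variance of
      \<open>\<bar>f\<bar>\<close>: its mean is \<open>S 1\<close>, so centring it there turns
      \<open>V\<close> into a squared discrete norm.\<close>
    let ?g = "\<lambda>x. \<bar>f x\<bar>"
    let ?h = "\<lambda>x. ?g x - (LINT y:\<Omega>|lebesgue. ?g y)"
    have mean: "(LINT y:\<Omega>|lebesgue. ?g y) = S 1"
      using LINT[of 1] by simp
    have C: "C\<^sub>p > 0" using assms(7) by (simp add: poincare_wirtinger_constant_def)
    have "V = (\<Sum>K\<in>cells M. measure lebesgue K * (a K - S 1)\<^sup>2)"
      unfolding V_def S_def using weighted_variance[OF m1, of a] by (simp add: a_def)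
    also have "\<dots> = (discrete_norm M 2 ?h)\<^sup>2"
      unfolding discrete_norm_2_power2 mean a_def
      using cell_value_comp[OF f _ D(8), of _ "\<lambda>y. \<bar>y\<bar> - S 1"]
      by (intro sum.cong) auto
    also have "\<dots> \<le> (C\<^sub>p * \<xi> powr (- 1 / 2) * discrete_seminorm M f)\<^sup>2"
    proof (rule power_mono)
      have "discrete_norm M 2 ?h \<le> C\<^sub>p * \<xi> powr (- 1 / 2) * discrete_seminorm M ?g"
        using assms discrete_functions_comp[OF f, of abs]
        unfolding poincare_wirtinger_constant_def by blast
      also have "\<dots> \<le> C\<^sub>p * \<xi> powr (- 1 / 2) * discrete_seminorm M f"
        using C by (intro mult_left_mono discrete_seminorm_abs_le[OF M f]) auto
      finally show "discrete_norm M 2 ?h \<le> C\<^sub>p * \<xi> powr (- 1 / 2) * discrete_seminorm M f" .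
      show "0 \<le> discrete_norm M 2 ?h" by (simp add: discrete_norm_def)
    qed
    also have "\<dots> = C\<^sub>p\<^sup>2 / \<xi> * (discrete_seminorm M f)\<^sup>2"
    proof -
      have "(\<xi> powr (- 1 / 2))\<^sup>2 = 1 / \<xi>"
        using \<open>\<xi> > 0\<close> by (simp add: power2_eq_square powr_minus_divide flip: powr_add)
      then show ?thesis by (simp add: power_mult_distrib)
    qed
    finally show "V \<le> C\<^sub>p\<^sup>2 / \<xi> * (discrete_seminorm M f)\<^sup>2" .
    show "0 \<le> c" using assms by (auto simp: c_def)
  qed
  also have "\<dots> = beckner_constant C\<^sub>p \<xi> p q * (discrete_seminorm M f)\<^sup>2"
    by (simp add: c_def beckner_constant_def)
  finally show ?thesis .
qed

end
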